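(* Let $X$ be a Hilbert space, let $\mathbf{\Omega}=\{\Omega_1,\Omega_2\}$ be a collection of two subsets of $X$, and let $\bar x\in\Omega_1\cap\Omega_2$. Then $$\hat c[\mathbf{\Omega}](\bar x)=\lim_{\delta\downarrow0}\sup\left\{-\langle x_1^*,x_2^*\rangle\ \middle|\ x_i^*\in\widehat N_{\Omega_i}(\bar x,\delta),\ \|x_i^*\|=1\ (i=1,2)\right\},$$ where it is assumed that the supremum over the empty set equals $-1$.
   Context: $X^*$ is identified with the Hilbert space $X$; $B_\delta(x)$ is the closed ball with center $x$ and radius $\delta$. For $\Omega\subset X$ and $x\in\Omega$, the Fréchet normal cone is $N_\Omega(x)=\{x^*\in X\mid\limsup_{y\to x,\,y\in\Omega}\frac{\langle x^*,y-x\rangle}{\|y-x\|}\le0\}$ (equal to $X$ if $x$ is isolated in $\Omega$). For $\bar x\in\Omega$ and $\delta\ge0$, $\widehat N_\Omega(\bar x,\delta)=\bigcup_{x\in\Omega\cap B_\delta(\bar x)}N_\Omega(x)$. Constants: $$\hat\eta[\mathbf{\Omega}](\bar x)=\lim_{\delta\downarrow0}\inf\{\|x_1^*+x_2^*\|\mid x_i^*\in\widehat N_{\Omega_i}(\bar x,\delta)\ (i=1,2),\ \|x_1^*\|+\|x_2^*\|=1\},$$ where the infimum over the empty set equals $1$, and $$\hat c[\mathbf{\Omega}](\bar x)=1-2(\hat\eta[\mathbf{\Omega}](\bar x))^2.$$ *)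

theory Defs
  imports "HOL-Analysis.Analysis"
begin

text \<open>The dual of the Hilbert space is identified with the space itself, so functionals are
  represented by vectors through the inner product.\<close>

text \<open>The upper limit is taken in the extended reals. The filter \<open>at x within \<Omega>\<close> excludes
  \<open>x\<close> itself; at an isolated point it is \<open>bot\<close>, the upper limit is \<open>-\<infinity>\<close>, and the cone
  is the whole space.\<close>

definition frechet_normal_cone :: "'a::real_inner set \<Rightarrow> 'a \<Rightarrow> 'a set" where
  "frechet_normal_cone \<Omega> x =
     {xs. Limsup (at x within \<Omega>) (\<lambda>y. ereal (inner xs (y - x) / norm (y - x))) \<le> 0}"

lemma frechet_normal_cone_isolated:
  assumes "\<not> x islimpt \<Omega>"
  shows "frechet_normal_cone \<Omega> x = UNIV"
proof -
  have "at x within \<Omega> = bot"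
    using assms trivial_limit_within by blast
  then show ?thesis
    by (simp add: frechet_normal_cone_def Limsup_bot)
qed

definition normals_near :: "'a::real_inner set \<Rightarrow> 'a \<Rightarrow> real \<Rightarrow> 'a set" where
  "normals_near \<Omega> x \<delta> = (\<Union>y\<in>\<Omega> \<inter> cball x \<delta>. frechet_normal_cone \<Omega> y)"

definition Inf_default :: "real \<Rightarrow> real set \<Rightarrow> real" where
  "Inf_default d S = (if S = {} then d else Inf S)"

definition Sup_default :: "real \<Rightarrow> real set \<Rightarrow> real" where
  "Sup_default d S = (if S = {} then d else Sup S)"

definition eta_inf :: "'a::real_inner set \<Rightarrow> 'a set \<Rightarrow> 'a \<Rightarrow> real \<Rightarrow> real" where
  "eta_inf \<Omega>\<^sub>1 \<Omega>\<^sub>2 x \<delta> =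
     Inf_default 1 {norm (x1 + x2) | x1 x2.
       x1 \<in> normals_near \<Omega>\<^sub>1 x \<delta> \<and> x2 \<in> normals_near \<Omega>\<^sub>2 x \<delta> \<and> norm x1 + norm x2 = 1}"

definition eta_hat :: "'a::real_inner set \<Rightarrow> 'a set \<Rightarrow> 'a \<Rightarrow> real" where
  "eta_hat \<Omega>\<^sub>1 \<Omega>\<^sub>2 x = Lim (at_right 0) (eta_inf \<Omega>\<^sub>1 \<Omega>\<^sub>2 x)"

text \<open>The limit in \<open>eta_hat\<close> always exists: the infimum is bounded and grows as the radius
  shrinks.\<close>

lemma normals_near_mono: "\<delta> \<le> \<epsilon> \<Longrightarrow> normals_near \<Omega> x \<delta> \<subseteq> normals_near \<Omega> x \<epsilon>"
  by (auto simp: normals_near_def)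

lemma eta_inf_le_1: "eta_inf \<Omega>\<^sub>1 \<Omega>\<^sub>2 x \<delta> \<le> 1"
proof -
  let ?S = "{norm (x1 + x2) | x1 x2.
    x1 \<in> normals_near \<Omega>\<^sub>1 x \<delta> \<and> x2 \<in> normals_near \<Omega>\<^sub>2 x \<delta> \<and> norm x1 + norm x2 = 1}"
  have "Inf ?S \<le> 1" if ne: "?S \<noteq> {}"
  proof -
    from ne obtain s where s: "s \<in> ?S" by blast
    have "bdd_below ?S" by (rule bdd_belowI[of _ 0]) auto
    then have "Inf ?S \<le> s" using s by (rule cInf_lower[rotated])
    also have "s \<le> 1" using s by (auto intro: order_trans[OF norm_triangle_ineq])
    finally show ?thesis .
  qed
  then show ?thesis unfolding eta_inf_def Inf_default_def by auto
qed

lemma eta_inf_antimono: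
  assumes "\<delta> \<le> \<epsilon>"
  shows "eta_inf \<Omega>\<^sub>1 \<Omega>\<^sub>2 x \<epsilon> \<le> eta_inf \<Omega>\<^sub>1 \<Omega>\<^sub>2 x \<delta>"
proof -
  let ?S = "\<lambda>\<delta>. {norm (x1 + x2) | x1 x2.
    x1 \<in> normals_near \<Omega>\<^sub>1 x \<delta> \<and> x2 \<in> normals_near \<Omega>\<^sub>2 x \<delta> \<and> norm x1 + norm x2 = 1}"
  have sub: "?S \<delta> \<subseteq> ?S \<epsilon>"
    using normals_near_mono[OF assms, of \<Omega>\<^sub>1 x] normals_near_mono[OF assms, of \<Omega>\<^sub>2 x] by blast
  have bdd: "bdd_below (?S \<epsilon>)" by (rule bdd_belowI[of _ 0]) auto
  show ?thesis
  proof (cases "?S \<delta> = {}")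
    case True
    then have "eta_inf \<Omega>\<^sub>1 \<Omega>\<^sub>2 x \<delta> = 1" unfolding eta_inf_def Inf_default_def by (simp only: refl if_True)
    then show ?thesis using eta_inf_le_1 by metis
  next
    case False
    then have "?S \<epsilon> \<noteq> {}" using sub by blast
    then show ?thesis
      using False cInf_superset_mono[OF False bdd sub]
      unfolding eta_inf_def Inf_default_def by (simp only: if_False)
  qed
qed

lemma eta_hat_tendsto: "(eta_inf \<Omega>\<^sub>1 \<Omega>\<^sub>2 x \<longlongrightarrow> eta_hat \<Omega>\<^sub>1 \<Omega>\<^sub>2 x) (at_right 0)"
proof -
  let ?f = "eta_inf \<Omega>\<^sub>1 \<Omega>\<^sub>2 x"
  let ?L = "SUP \<delta>\<in>{0<..}. ?f \<delta>"
  have bdd: "bdd_above (?f ` {0<..})" by (rule bdd_aboveI[of _ 1]) (auto intro: eta_inf_le_1)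
  have "(?f \<longlongrightarrow> ?L) (at_right 0)"
  proof (rule order_tendstoI)
    fix a assume "a < ?L"
    then obtain \<delta> where \<delta>: "\<delta> > 0" "a < ?f \<delta>"
      using less_cSUP_iff[OF _ bdd, of a] by auto
    have "a < ?f t" if "t < \<delta>" for t
      using \<delta>(2) eta_inf_antimono[of t \<delta> \<Omega>\<^sub>1 \<Omega>\<^sub>2 x] that by linarith
    then show "\<forall>\<^sub>F t in at_right 0. a < ?f t"
      using \<delta>(1) by (auto simp: eventually_at_right_field)
  next
    fix a assume a: "?L < a"
    have "?f t < a" if "0 < t" for t
      using cSUP_upper[OF _ bdd, of t] that a by force
    then show "\<forall>\<^sub>F t in at_right 0. ?f t < a"
      by (auto simp: eventually_at_right_field intro: exI[of _ 1])
  qed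
  then show ?thesis
    unfolding eta_hat_def by (metis tendsto_Lim trivial_limit_at_right_real)
qed

definition c_hat :: "'a::real_inner set \<Rightarrow> 'a set \<Rightarrow> 'a \<Rightarrow> real" where
  "c_hat \<Omega>\<^sub>1 \<Omega>\<^sub>2 x = 1 - 2 * (eta_hat \<Omega>\<^sub>1 \<Omega>\<^sub>2 x)\<^sup>2"

end

(* The equality already holds at each radius, before passing to the limit. Normal cones are stable
   under positive scaling, so unit normals u1, u2 give the admissible pair u1/2, u2/2, and
   |u1/2 + u2/2|^2 = (1 + <u1,u2>)/2. Conversely, if |x1| + |x2| = 1 with both nonzero and c is the
   cosine of their angle, then |x1 + x2|^2 = 1 - 2 |x1| |x2| (1 - c) >= (1 + c)/2, since
   |x1| |x2| <= 1/4. Pairs with a zero entry give |x1 + x2| = 1, which matches the conventions for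
   the empty set. *)

theory Submission
  imports Defs
begin

text \<open>Trades the upper limit in the extended reals for eventual bounds by positive reals. The
  only other positive bound is \<open>\<infinity>\<close>, which every real quotient satisfies. At
  an isolated point the filter is \<open>bot\<close>, so both sides hold.\<close>

lemma mem_frechet_normal_cone_iff:
  "v \<in> frechet_normal_cone \<Omega> x \<longleftrightarrow>
     (\<forall>e>0. \<forall>\<^sub>F y in at x within \<Omega>. inner v (y - x) / norm (y - x) < e)"
proof -
  have "(\<forall>z>0. \<forall>\<^sub>F y in at x within \<Omega>. ereal (inner v (y - x) / norm (y - x)) < z) \<longleftrightarrow>
        (\<forall>e>0. \<forall>\<^sub>F y in at x within \<Omega>. inner v (y - x) / norm (y - x) < e)" (is "?L \<longleftrightarrow> ?R")
  proof
    assume L: ?L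
    show ?R
    proof (intro allI impI)
      fix e :: real assume "e > 0"
      then show "\<forall>\<^sub>F y in at x within \<Omega>. inner v (y - x) / norm (y - x) < e"
        using L[rule_format, of "ereal e"] by simp
    qed
  next
    assume R: ?R
    show ?L
    proof (intro allI impI)
      fix z :: ereal assume z: "z > 0"
      show "\<forall>\<^sub>F y in at x within \<Omega>. ereal (inner v (y - x) / norm (y - x)) < z"
        using z R by (cases z) auto
    qed
  qed
  then show ?thesis
    by (simp add: frechet_normal_cone_def Limsup_le_iff)
qed

lemma frechet_normal_cone_scaleR:
  assumes "v \<in> frechet_normal_cone \<Omega> x" "c > 0"
  shows "c *\<^sub>R v \<in> frechet_normal_cone \<Omega> x"
  unfolding mem_frechet_normal_cone_iff
proof (intro allI impI)
  fix e :: real assume "e > 0"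
  then have "\<forall>\<^sub>F y in at x within \<Omega>. inner v (y - x) / norm (y - x) < e / c"
    using assms by (auto simp: mem_frechet_normal_cone_iff)
  then show "\<forall>\<^sub>F y in at x within \<Omega>. inner (c *\<^sub>R v) (y - x) / norm (y - x) < e"
    by eventually_elim (use \<open>c > 0\<close> in \<open>simp add: pos_less_divide_eq mult.commute\<close>)
qed

text \<open>Passes between the two normalizations: factor 1/2 leads from unit normals to norms with
  sum one, the inverse norms lead back.\<close>

lemma normals_near_scaleR:
  assumes "v \<in> normals_near \<Omega> x \<delta>" "c > 0"
  shows "c *\<^sub>R v \<in> normals_near \<Omega> x \<delta>"
  using assms frechet_normal_cone_scaleR unfolding normals_near_def by blast

lemma norm_half_add_unit:
  fixes u v :: "'a::real_inner"
  assumes "norm u = 1" "norm v = 1"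
  shows "(norm ((1/2) *\<^sub>R u + (1/2) *\<^sub>R v))\<^sup>2 = (1 + inner u v) / 2"
  using assms
  by (simp add: power2_norm_eq_inner inner_add_left inner_add_right inner_commute norm_eq_1 field_simps)

lemma norm_add_normalized_le:
  fixes x y :: "'a::real_inner"
  assumes "norm x + norm y = 1" "x \<noteq> 0" "y \<noteq> 0"
  shows "(1 + inner (x /\<^sub>R norm x) (y /\<^sub>R norm y)) / 2 \<le> (norm (x + y))\<^sup>2"
proof -
  define c where "c = inner (x /\<^sub>R norm x) (y /\<^sub>R norm y)"
  \<comment> \<open>Cauchy-Schwarz makes \<open>1 - c\<close> nonnegative, so the bound on the
    product of the norms can be multiplied by it below.\<close>
  have c1: "c \<le> 1"
    using norm_cauchy_schwarz[of "x /\<^sub>R norm x" "y /\<^sub>R norm y"] assms by (simp add: c_def)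
  have "inner x y = norm x * norm y * c"
    using assms by (simp add: c_def field_simps)
  then have "(norm (x + y))\<^sup>2 = (norm x)\<^sup>2 + (norm y)\<^sup>2 + 2 * (norm x * norm y * c)"
    by (simp add: power2_norm_eq_inner inner_add_left inner_add_right inner_commute)
  also have "\<dots> = (norm x + norm y)\<^sup>2 - 2 * (norm x * norm y) * (1 - c)"
    by (simp add: power2_eq_square algebra_simps)
  finally have eq: "(norm (x + y))\<^sup>2 = 1 - 2 * (norm x * norm y) * (1 - c)"
    using assms by simp
  have "4 * (norm x * norm y) = (norm x + norm y)\<^sup>2 - (norm x - norm y)\<^sup>2"
    by (simp add: power2_eq_square algebra_simps)
  then have "2 * (norm x * norm y) \<le> 1/2"
    using assms by simp
  then have "2 * (norm x * norm y) * (1 - c) \<le> 1/2 * (1 - c)"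
    using c1 by (intro mult_right_mono) auto
  then show ?thesis
    unfolding eq c_def[symmetric] by (simp add: field_simps)
qed

text \<open>The map sending s to 1 - 2 s^2 decreases for s \<ge> 0, so it turns an infimum into a
  supremum. Its values on \<open>S\<close> contain \<open>T\<close>, and each of them is either
  dominated by an element of \<open>T\<close> or equal to -1.\<close>

lemma Sup_neg_inner_eq_eta_inf:
  fixes \<Omega>\<^sub>1 \<Omega>\<^sub>2 :: "'a::real_inner set"
  shows "Sup_default (-1) {- inner x1 x2 | x1 x2.
           x1 \<in> normals_near \<Omega>\<^sub>1 x \<delta> \<and> x2 \<in> normals_near \<Omega>\<^sub>2 x \<delta> \<and> norm x1 = 1 \<and> norm x2 = 1}
         = 1 - 2 * (eta_inf \<Omega>\<^sub>1 \<Omega>\<^sub>2 x \<delta>)\<^sup>2"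
proof -
  let ?N1 = "normals_near \<Omega>\<^sub>1 x \<delta>" and ?N2 = "normals_near \<Omega>\<^sub>2 x \<delta>"
  define S where "S = {norm (x1 + x2) | x1 x2. x1 \<in> ?N1 \<and> x2 \<in> ?N2 \<and> norm x1 + norm x2 = 1}"
  define T where "T = {- inner x1 x2 | x1 x2. x1 \<in> ?N1 \<and> x2 \<in> ?N2 \<and> norm x1 = 1 \<and> norm x2 = 1}"
  have eta: "eta_inf \<Omega>\<^sub>1 \<Omega>\<^sub>2 x \<delta> = Inf_default 1 S"
    by (simp only: eta_inf_def S_def)
  have T_to_S: "\<exists>s\<in>S. t = 1 - 2 * s\<^sup>2" if "t \<in> T" for t
  proof -
    from that obtain u v where uv: "t = - inner u v" "u \<in> ?N1" "v \<in> ?N2" "norm u = 1" "norm v = 1"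
      unfolding T_def by blast
    have "norm ((1/2) *\<^sub>R u + (1/2) *\<^sub>R v) \<in> S"
    proof -
      have "norm ((1/2) *\<^sub>R u) + norm ((1/2) *\<^sub>R v) = 1"
        using uv by simp
      moreover have "(1/2) *\<^sub>R u \<in> ?N1" "(1/2) *\<^sub>R v \<in> ?N2"
        using uv by (auto intro: normals_near_scaleR)
      ultimately show ?thesis
        unfolding S_def by blast
    qed
    moreover have "t = 1 - 2 * (norm ((1/2) *\<^sub>R u + (1/2) *\<^sub>R v))\<^sup>2"
      using uv by (simp only: norm_half_add_unit) (simp add: field_simps)
    ultimately show ?thesis by blast
  qed
  have S_to_T: "s = 1 \<or> (\<exists>t\<in>T. 1 - 2 * s\<^sup>2 \<le> t)" if "s \<in> S" for s
  proof -
    from that obtain y z where yz: "s = norm (y + z)" "y \<in> ?N1" "z \<in> ?N2" "norm y + norm z = 1"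
      unfolding S_def by blast
    show ?thesis
    proof (cases "y = 0 \<or> z = 0")
      case True
      then show ?thesis using yz by auto
    next
      case False
      let ?t = "- inner (y /\<^sub>R norm y) (z /\<^sub>R norm z)"
      have "y /\<^sub>R norm y \<in> ?N1" "z /\<^sub>R norm z \<in> ?N2"
        using False yz by (auto intro: normals_near_scaleR)
      moreover have "norm (y /\<^sub>R norm y) = 1" "norm (z /\<^sub>R norm z) = 1"
        using False by auto
      ultimately have "?t \<in> T"
        unfolding T_def by blast
      moreover have "1 - 2 * s\<^sup>2 \<le> ?t"
        using norm_add_normalized_le[OF yz(4)] False yz(1) by (simp add: field_simps)
      ultimately show ?thesis by blast
    qed
  qed
  have S_nonneg: "0 \<le> s" if "s \<in> S" for s
    using that unfolding S_def by auto
  have "Sup_default (-1) T = 1 - 2 * (Inf_default 1 S)\<^sup>2"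
  proof (cases "T = {}")
    case True
    \<comment> \<open>Whether \<open>S\<close> is empty or consists of 1 alone, the defaults agree:
      1 - 2 * 1^2 = -1.\<close>
    then have "S \<subseteq> {1}" using S_to_T by auto
    then have "S = {} \<or> S = {1}" by blast
    then have "Inf_default 1 S = 1" by (auto simp: Inf_default_def)
    then show ?thesis using True by (simp add: Sup_default_def)
  next
    case False
    then have Sne: "S \<noteq> {}" using T_to_S by blast
    have m0: "0 \<le> Inf S" using Sne S_nonneg by (rule cInf_greatest)
    have "Sup T = 1 - 2 * (Inf S)\<^sup>2"
    proof (rule cSup_eq_non_empty[OF False])
      fix t assume "t \<in> T"
      then obtain s where s: "s \<in> S" "t = 1 - 2 * s\<^sup>2" using T_to_S by blast
      have "Inf S \<le> s"
        using s(1) S_nonneg by (intro cInf_lower bdd_belowI)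
      then have "(Inf S)\<^sup>2 \<le> s\<^sup>2"
        using m0 by (rule power_mono)
      then show "t \<le> 1 - 2 * (Inf S)\<^sup>2" using s by simp
    next
      fix B assume B: "\<And>t. t \<in> T \<Longrightarrow> t \<le> B"
      \<comment> \<open>Covers the case s = 1 of \<open>S_to_T\<close>, which supplies no element of
        \<open>T\<close> to compare with.\<close>
      have "- 1 \<le> B"
      proof -
        from False obtain t where t: "t \<in> T" by blast
        then obtain u v :: 'a where "t = - inner u v" "norm u = 1" "norm v = 1"
          unfolding T_def by blast
        then show ?thesis
          using B[OF t] norm_cauchy_schwarz[of u v] by simp
      qed
      \<comment> \<open>Solving 1 - 2 s^2 \<le> B for s gives a lower bound common to all of
        \<open>S\<close>, which passes to \<open>Inf S\<close>. If B > 1 the radicand is negative,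
        and both rules about \<open>sqrt\<close> remain valid.\<close>
      have "sqrt ((1 - B) / 2) \<le> s" if "s \<in> S" for s
      proof (rule real_le_lsqrt)
        show "0 \<le> s" using S_nonneg that .
        have "1 - 2 * s\<^sup>2 \<le> B"
          using S_to_T[OF that] B \<open>- 1 \<le> B\<close> by fastforce
        then show "(1 - B) / 2 \<le> s\<^sup>2" by simp
      qed
      then have "sqrt ((1 - B) / 2) \<le> Inf S"
        using Sne by (intro cInf_greatest)
      then have "(1 - B) / 2 \<le> (Inf S)\<^sup>2"
        by (rule sqrt_le_D)
      then show "1 - 2 * (Inf S)\<^sup>2 \<le> B" by simp
    qed
    then show ?thesis using False Sne by (simp add: Sup_default_def Inf_default_def)
  qed
  then show ?thesis
    unfolding eta T_def .
qed

theorem proposition6: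
  fixes \<Omega>\<^sub>1 \<Omega>\<^sub>2 :: "'a::{real_inner, complete_space} set" and x :: 'a
  assumes "x \<in> \<Omega>\<^sub>1 \<inter> \<Omega>\<^sub>2"
  shows "((\<lambda>\<delta>. Sup_default (-1) {- inner x1 x2 | x1 x2.
             x1 \<in> normals_near \<Omega>\<^sub>1 x \<delta> \<and> x2 \<in> normals_near \<Omega>\<^sub>2 x \<delta> \<and> norm x1 = 1 \<and> norm x2 = 1})
           \<longlongrightarrow> c_hat \<Omega>\<^sub>1 \<Omega>\<^sub>2 x) (at_right 0)"
  \<comment> \<open>The rewriting happens under the binder, radius by radius. What remains is the
    convergence of \<open>eta_inf\<close>, which comes from monotonicity, and the continuity of a
    polynomial.\<close>
  unfolding Sup_neg_inner_eq_eta_inf c_hat_def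
  by (intro tendsto_intros eta_hat_tendsto)

end
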